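(* There is no prime functional digraph. That is, for every non-empty functional digraph $X$ that is not isomorphic to $C_1$, there exist functional digraphs $A$ and $B$ such that $X \mid AB$ but $X \nmid A$ and $X \nmid B$.
   Context: A functional digraph is a finite directed graph $X$ (loops allowed) in which each vertex $x$ has exactly one out-neighbor, denoted $X(x)$; equivalently, it is a function from a finite set $V(X)$ to itself. The set of functional digraphs is denoted $\mathbb{F}$. Functional digraphs are considered up to isomorphism, and $A=B$ means that $A$ and $B$ are isomorphic, i.e. there is a bijection $\phi:V(A)\to V(B)$ with $\phi(A(a))=B(\phi(a))$ for all $a\in V(A)$. The product $AB$ (or $A\cdot B$) is the direct product: $V(AB)=V(A)\times V(B)$ and $(AB)(a,b)=(A(a),B(b))$. $C_1$ denotes the cycle of length one (a single vertex with a loop), which is the identity for the product. For $A,B\in\mathbb{F}$, $A\mid B$ ($A$ divides $B$) means that there exists $Y\in\mathbb{F}$ with $AY=B$. A non-empty functional digraph $X$ is prime if $X\neq C_1$ and, for all $A,B\in\mathbb{F}$, $X\mid AB$ implies $X\mid A$ or $X\mid B$. *)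

theory Defs
  imports Main
begin

record 'a fdigraph =
  verts :: "'a set"
  out_nbr :: "'a \<Rightarrow> 'a"

text \<open>The map \<open>out_nbr\<close> is total on the type, but only its values on \<open>verts\<close> matter.
  The empty functional digraph is allowed.\<close>

definition functional_digraph :: "'a fdigraph \<Rightarrow> bool" where
  "functional_digraph X \<longleftrightarrow> finite (verts X) \<and> out_nbr X ` verts X \<subseteq> verts X"

definition fd_iso :: "'a fdigraph \<Rightarrow> 'b fdigraph \<Rightarrow> bool" where
  "fd_iso A B \<longleftrightarrow>
     (\<exists>\<phi>. bij_betw \<phi> (verts A) (verts B) \<and>
          (\<forall>a\<in>verts A. \<phi> (out_nbr A a) = out_nbr B (\<phi> a)))"

definition fd_prod :: "'a fdigraph \<Rightarrow> 'b fdigraph \<Rightarrow> ('a \<times> 'b) fdigraph" where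
  "fd_prod A B =
     \<lparr>verts = verts A \<times> verts B, out_nbr = (\<lambda>(a, b). (out_nbr A a, out_nbr B b))\<rparr>"

definition C1 :: "unit fdigraph" where
  "C1 = \<lparr>verts = {()}, out_nbr = id\<rparr>"

text \<open>A definition cannot quantify over types, so the bound digraphs below have their vertices
  in \<open>nat\<close>. By \<open>ex_nat_representative\<close> every isomorphism class is represented there, so this is
  no restriction.\<close>

lemma ex_nat_representative:
  assumes "functional_digraph X"
  shows "\<exists>Y :: nat fdigraph. functional_digraph Y \<and> fd_iso X Y"
proof -
  obtain f :: "'a \<Rightarrow> nat" and n where f: "f ` verts X = {i. i < n}" "inj_on f (verts X)"
    using assms finite_imp_inj_to_nat_seg unfolding functional_digraph_def by metis
  define g where "g = inv_into (verts X) f"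
  define Y where "Y = \<lparr>verts = f ` verts X, out_nbr = (\<lambda>i. f (out_nbr X (g i)))\<rparr>"
  have g: "g (f x) = x" if "x \<in> verts X" for x
    using f(2) that by (simp add: g_def)
  have "functional_digraph Y"
    using assms g by (auto simp: functional_digraph_def Y_def)
  moreover have "fd_iso X Y"
    using f(2) g by (auto simp: fd_iso_def Y_def bij_betw_def)
  ultimately show ?thesis by blast
qed

definition fd_dvd :: "'a fdigraph \<Rightarrow> 'b fdigraph \<Rightarrow> bool" where
  "fd_dvd A B \<longleftrightarrow> (\<exists>Y :: nat fdigraph. functional_digraph Y \<and> fd_iso (fd_prod A Y) B)"

definition fd_prime :: "'a fdigraph \<Rightarrow> bool" where
  "fd_prime X \<longleftrightarrow>
     functional_digraph X \<and> verts X \<noteq> {} \<and> \<not> fd_iso X C1 \<and>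
     (\<forall>(A :: nat fdigraph) (B :: nat fdigraph). functional_digraph A \<longrightarrow> functional_digraph B \<longrightarrow>
        fd_dvd X (fd_prod A B) \<longrightarrow> fd_dvd X A \<or> fd_dvd X B)"

end

theory Submission
  imports Defs
begin

text \<open>
  Let \<open>X\<close> be non-empty and not \<open>C\<^sub>1\<close>.  In each of three cases the witnesses for
  non-primality come from an \<^emph>\<open>absorbing\<close> factor, a digraph that blurs what keeps \<open>X\<close> from dividing
  the other one: in the first two cases the difference between that digraph and a multiple
  of \<open>X\<close>, in the third the fact that its cofactor is only a formal difference of digraphs.

  \<^emph>\<open>\<open>X\<close> is disconnected\<close>, say \<open>X = S + T\<close>.  The cycle \<open>C\<^sub>p\<close> satisfies
  \<open>C\<^sub>p C\<^sub>p = p C\<^sub>p\<close>, so it does not distinguish \<open>C\<^sub>p\<close> from \<open>p\<close> loops.  Hence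
  \<open>C\<^sub>p (p S + C\<^sub>p T) = p C\<^sub>p (S + T)\<close> is a multiple of \<open>X\<close>.  If \<open>p\<close> is large
  and prime to all numbers up to the size of \<open>X\<close>, then \<open>X\<close> does not divide \<open>C\<^sub>p\<close> for reasons of
  size.  Nor does it divide \<open>p S + C\<^sub>p T\<close>: comparing the vertices on cycles of length prime to \<open>p\<close>,
  the number of cyclic vertices of \<open>X\<close> would divide \<open>p\<close> times that of \<open>S\<close>
  (\<open>disconnected_not_prime\<close>).

  \<^emph>\<open>\<open>X\<close> is connected with a cycle of length \<open>n \<ge> 2\<close>\<close>.  Let \<open>U\<close> be the connected cover of \<open>X\<close>
  whose cycle has length \<open>n\<^sup>2\<close>.  The cycle of length \<open>n\<^sup>2\<close> does not distinguish \<open>U\<close> from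
  \<open>n X\<close>, so \<open>X\<close> divides the product of that cycle and \<open>U\<close>.  It divides neither of them,
  because the cofactor would have at most \<open>n\<close> vertices and no cycle of length at most \<open>n\<close>
  combines with one of length \<open>n\<close> to cycles of length \<open>n\<^sup>2\<close> only
  (\<open>phased_not_prime\<close>).

  \<^emph>\<open>\<open>X\<close> is a tree with a loop at its root\<close>, of height \<open>h \<ge> 1\<close>.  Let \<open>E\<close> be \<open>X\<close> with a new leaf
  on each vertex of height \<open>h\<close>, and let \<open>A = (X \<times> E) \<union> (E \<times> X)\<close> inside \<open>E E\<close>; formally
  \<open>A\<close> behaves like \<open>X (2 E - X)\<close>, where the second factor is not a digraph: a
  vertex of \<open>X\<close> would have to carry new leaves twice, once on a copy of its branch that does not
  exist.  Multiplying by the complete \<open>b\<close>-ary tree \<open>B\<close> of height \<open>h\<close> supplies the missing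
  copies, because the root of \<open>B\<close> has a loop and another in-neighbour with trees that agree as
  far up as the branches of \<open>X\<close> reach.  So \<open>(2 E - X) B\<close> is a digraph \<open>Y\<close> and
  \<open>A B = X Y\<close>.  The isomorphism is the involution \<open>exchange\<close>, which swaps the two tree
  coordinates on part of the product (\<open>truncated_tree_not_prime\<close>).

  All non-divisibilities follow from three multiplicative counts: the vertices, the points fixed by
  an iterate, and the vertices within one step of a fixed point that have an ancestor a given
  number of generations back.
\<close>

section \<open>Isomorphism, products and divisibility\<close>

lemma fd_iso_sym:
  assumes "functional_digraph A" "fd_iso A B"
  shows "fd_iso B A"
proof -
  obtain \<phi> where \<phi>: "bij_betw \<phi> (verts A) (verts B)"
    "\<And>a. a \<in> verts A \<Longrightarrow> \<phi> (out_nbr A a) = out_nbr B (\<phi> a)"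
    using assms(2) by (auto simp: fd_iso_def)
  define \<psi> where "\<psi> = inv_into (verts A) \<phi>"
  have \<psi>: "bij_betw \<psi> (verts B) (verts A)"
    using \<phi>(1) by (simp add: \<psi>_def bij_betw_inv_into)
  have "\<psi> (out_nbr B b) = out_nbr A (\<psi> b)" if b: "b \<in> verts B" for b
  proof -
    have a: "\<psi> b \<in> verts A" "\<phi> (\<psi> b) = b"
      using \<psi> b \<phi>(1) by (auto simp: \<psi>_def bij_betw_def f_inv_into_f inv_into_into)
    moreover have "out_nbr A (\<psi> b) \<in> verts A"
      using assms(1) a by (auto simp: functional_digraph_def)
    ultimately show ?thesis
      using \<phi> by (metis \<psi>_def bij_betw_inv_into_left)
  qed
  with \<psi> show ?thesis by (auto simp: fd_iso_def)
qed

lemma fd_iso_trans: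
  assumes "fd_iso A B" "fd_iso B C"
  shows "fd_iso A C"
proof -
  obtain \<phi> where \<phi>: "bij_betw \<phi> (verts A) (verts B)"
    "\<And>a. a \<in> verts A \<Longrightarrow> \<phi> (out_nbr A a) = out_nbr B (\<phi> a)"
    using assms(1) by (auto simp: fd_iso_def)
  obtain \<psi> where \<psi>: "bij_betw \<psi> (verts B) (verts C)"
    "\<And>a. a \<in> verts B \<Longrightarrow> \<psi> (out_nbr B a) = out_nbr C (\<psi> a)"
    using assms(2) by (auto simp: fd_iso_def)
  have "bij_betw (\<psi> \<circ> \<phi>) (verts A) (verts C)"
    using \<phi>(1) \<psi>(1) by (rule bij_betw_trans)
  moreover have "(\<psi> \<circ> \<phi>) (out_nbr A a) = out_nbr C ((\<psi> \<circ> \<phi>) a)" if "a \<in> verts A" for a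
    using \<phi> \<psi> that by (auto simp: bij_betw_apply)
  ultimately show ?thesis unfolding fd_iso_def by blast
qed

lemma fd_iso_prod_cong:
  assumes "fd_iso A A'" "fd_iso B B'"
  shows "fd_iso (fd_prod A B) (fd_prod A' B')"
proof -
  obtain \<phi> where \<phi>: "bij_betw \<phi> (verts A) (verts A')"
    "\<And>a. a \<in> verts A \<Longrightarrow> \<phi> (out_nbr A a) = out_nbr A' (\<phi> a)"
    using assms(1) by (auto simp: fd_iso_def)
  obtain \<psi> where \<psi>: "bij_betw \<psi> (verts B) (verts B')"
    "\<And>a. a \<in> verts B \<Longrightarrow> \<psi> (out_nbr B a) = out_nbr B' (\<psi> a)"
    using assms(2) by (auto simp: fd_iso_def)
  have "bij_betw (map_prod \<phi> \<psi>) (verts A \<times> verts B) (verts A' \<times> verts B')"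
    using \<phi>(1) \<psi>(1) by (rule bij_betw_map_prod)
  with \<phi>(2) \<psi>(2) show ?thesis
    unfolding fd_iso_def fd_prod_def by (intro exI[of _ "map_prod \<phi> \<psi>"]) auto
qed

lemma fd_iso_refl: "fd_iso A A"
  unfolding fd_iso_def by (intro exI[of _ id]) auto

lemma functional_digraph_prod:
  "functional_digraph A \<Longrightarrow> functional_digraph B \<Longrightarrow> functional_digraph (fd_prod A B)"
  by (auto simp: functional_digraph_def fd_prod_def)

lemma fd_dvd_iso_right:
  assumes "fd_dvd X A" "fd_iso A B"
  shows "fd_dvd X B"
  using assms unfolding fd_dvd_def by (meson fd_iso_trans)

lemma fd_dvd_iso_left:
  assumes "fd_dvd X A" "fd_iso X' X"
  shows "fd_dvd X' A"
  using assms unfolding fd_dvd_def by (meson fd_iso_trans fd_iso_prod_cong fd_iso_refl)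

text \<open>Primality speaks of digraphs on natural numbers only.  This rule lets witnesses be built on
  whatever type describes them best.\<close>

lemma not_fd_primeI:
  assumes X: "functional_digraph X"
    and A: "functional_digraph A" and B: "functional_digraph B" and Y: "functional_digraph Y"
    and iso: "fd_iso (fd_prod X Y) (fd_prod A B)"
    and ndvd: "\<not> fd_dvd X A" "\<not> fd_dvd X B"
  shows "\<not> fd_prime X"
proof
  assume prime: "fd_prime X"
  obtain A' :: "nat fdigraph" where A': "functional_digraph A'" "fd_iso A A'"
    using ex_nat_representative[OF A] by blast
  obtain B' :: "nat fdigraph" where B': "functional_digraph B'" "fd_iso B B'"
    using ex_nat_representative[OF B] by blast
  obtain Y' :: "nat fdigraph" where Y': "functional_digraph Y'" "fd_iso Y Y'"
    using ex_nat_representative[OF Y] by blast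
  have "fd_iso (fd_prod X Y') (fd_prod X Y)"
    using fd_iso_sym[OF Y Y'(2)] by (intro fd_iso_prod_cong fd_iso_refl)
  then have "fd_iso (fd_prod X Y') (fd_prod A' B')"
    using iso fd_iso_prod_cong[OF A'(2) B'(2)] by (meson fd_iso_trans)
  then have "fd_dvd X (fd_prod A' B')"
    using Y'(1) by (auto simp: fd_dvd_def)
  then have "fd_dvd X A' \<or> fd_dvd X B'"
    using prime A'(1) B'(1) by (auto simp: fd_prime_def)
  then show False
    using ndvd fd_dvd_iso_right[OF _ fd_iso_sym[OF A A'(2)]]
      fd_dvd_iso_right[OF _ fd_iso_sym[OF B B'(2)]] by blast
qed

lemma fd_prime_iso:
  assumes prime: "fd_prime X" and X': "functional_digraph X'" and iso: "fd_iso X X'"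
  shows "fd_prime X'"
proof -
  have X: "functional_digraph X" using prime by (simp add: fd_prime_def)
  have "verts X' \<noteq> {}"
    using iso prime by (auto simp: fd_iso_def fd_prime_def bij_betw_def)
  moreover have "\<not> fd_iso X' C1"
    using prime fd_iso_trans[OF iso] by (auto simp: fd_prime_def)
  moreover have "fd_dvd X A \<longleftrightarrow> fd_dvd X' A" for A :: "(nat \<times> nat) fdigraph"
    using fd_dvd_iso_left[OF _ iso] fd_dvd_iso_left[OF _ fd_iso_sym[OF X iso]] by blast
  moreover have "fd_dvd X A \<longleftrightarrow> fd_dvd X' A" for A :: "nat fdigraph"
    using fd_dvd_iso_left[OF _ iso] fd_dvd_iso_left[OF _ fd_iso_sym[OF X iso]] by blast
  ultimately show ?thesis
    using prime X' by (simp add: fd_prime_def)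
qed

section \<open>Multiplicative invariants\<close>

lemma iterate_in_verts:
  assumes "functional_digraph G" "v \<in> verts G"
  shows "(out_nbr G ^^ j) v \<in> verts G"
  using assms by (induction j) (auto simp: functional_digraph_def)

lemma iterate_prod:
  "(out_nbr (fd_prod A B) ^^ j) (a, b) = ((out_nbr A ^^ j) a, (out_nbr B ^^ j) b)"
  by (induction j) (auto simp: fd_prod_def)

lemma iterate_hom:
  assumes "functional_digraph A"
    and "\<And>a. a \<in> verts A \<Longrightarrow> \<phi> (out_nbr A a) = out_nbr B (\<phi> a)"
    and "a \<in> verts A"
  shows "\<phi> ((out_nbr A ^^ j) a) = (out_nbr B ^^ j) (\<phi> a)"
  using assms iterate_in_verts[OF assms(1,3)] by (induction j) auto

definition periodic_points :: "nat \<Rightarrow> 'a fdigraph \<Rightarrow> 'a set" where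
  "periodic_points M G = {v \<in> verts G. (out_nbr G ^^ M) v = v}"

text \<open>The vertices that \<open>near_fixed\<close> counts are the roots of the branches at the fixed points (the
  fixed points themselves included) that reach at least \<open>j\<close> levels further up.\<close>

definition near_fixed :: "nat \<Rightarrow> 'a fdigraph \<Rightarrow> 'a set" where
  "near_fixed j G =
     {v \<in> (out_nbr G ^^ j) ` verts G. out_nbr G (out_nbr G v) = out_nbr G v}"

lemma periodic_points_prod:
  "periodic_points M (fd_prod A B) = periodic_points M A \<times> periodic_points M B"
proof (intro set_eqI, clarify)
  fix a b
  show "(a, b) \<in> periodic_points M (fd_prod A B) \<longleftrightarrow>
      (a, b) \<in> periodic_points M A \<times> periodic_points M B"
    by (auto simp: periodic_points_def iterate_prod) (auto simp: fd_prod_def)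
qed

lemma near_fixed_prod:
  "near_fixed j (fd_prod A B) = near_fixed j A \<times> near_fixed j B"
proof -
  have "(out_nbr (fd_prod A B) ^^ j) ` verts (fd_prod A B)
      = (\<lambda>(a, b). ((out_nbr A ^^ j) a, (out_nbr B ^^ j) b)) ` (verts A \<times> verts B)"
    by (rule image_cong) (auto simp: iterate_prod, auto simp: fd_prod_def)
  also have "\<dots> = (out_nbr A ^^ j) ` verts A \<times> (out_nbr B ^^ j) ` verts B"
    by force
  finally show ?thesis
    by (auto simp: near_fixed_def fd_prod_def)
qed

lemma card_iso:
  assumes A: "functional_digraph A" and iso: "fd_iso A B"
  shows "card (verts A) = card (verts B)"
    and "card (periodic_points M A) = card (periodic_points M B)"
    and "card (near_fixed j A) = card (near_fixed j B)"
proof -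
  obtain \<phi> where bij: "bij_betw \<phi> (verts A) (verts B)"
    and hom: "\<And>a. a \<in> verts A \<Longrightarrow> \<phi> (out_nbr A a) = out_nbr B (\<phi> a)"
    using iso by (auto simp: fd_iso_def)
  have it: "\<phi> ((out_nbr A ^^ k) a) = (out_nbr B ^^ k) (\<phi> a)" if "a \<in> verts A" for k a
    using iterate_hom[where \<phi> = \<phi>, OF A hom that] by blast
  have inj: "inj_on \<phi> (verts A)" and img: "\<phi> ` verts A = verts B"
    using bij by (auto simp: bij_betw_def)
  have clos: "(out_nbr A ^^ k) a \<in> verts A" if "a \<in> verts A" for k a
    using iterate_in_verts[OF A that] .
  have clos1: "out_nbr A a \<in> verts A" if "a \<in> verts A" for a
    using clos[OF that, of 1] by simp
  show "card (verts A) = card (verts B)"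
    using bij by (rule bij_betw_same_card)
  have eq: "(out_nbr B ^^ k) (\<phi> a) = \<phi> a \<longleftrightarrow> (out_nbr A ^^ k) a = a" if "a \<in> verts A" for k a
    using it[OF that, of k] clos[OF that, of k] that inj_on_eq_iff[OF inj] by metis
  have "\<phi> ` periodic_points M A = periodic_points M B"
    unfolding periodic_points_def img[symmetric] using eq by blast
  moreover have "inj_on \<phi> (periodic_points M A)"
    using inj by (rule inj_on_subset) (auto simp: periodic_points_def)
  ultimately show "card (periodic_points M A) = card (periodic_points M B)"
    by (metis card_image)
  have sub: "near_fixed j A \<subseteq> verts A"
    using clos by (auto simp: near_fixed_def)
  have eq': "out_nbr B (out_nbr B (\<phi> a)) = out_nbr B (\<phi> a)
      \<longleftrightarrow> out_nbr A (out_nbr A a) = out_nbr A a" if "a \<in> verts A" for a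
    using that hom clos1 inj_on_eq_iff[OF inj] by metis
  have im: "(out_nbr B ^^ j) ` verts B = \<phi> ` (out_nbr A ^^ j) ` verts A"
    unfolding img[symmetric] image_image using it by (intro image_cong) auto
  have "\<phi> ` near_fixed j A = near_fixed j B"
    unfolding near_fixed_def im using eq' clos by blast
  then show "card (near_fixed j A) = card (near_fixed j B)"
    using inj_on_subset[OF inj sub] by (metis card_image)
qed

text \<open>Divisibility is refuted only through these three factorisations of numbers.\<close>

lemma fd_dvd_factorisations:
  assumes "functional_digraph X" "fd_dvd X A"
  obtains Y :: "nat fdigraph" where "functional_digraph Y"
    "card (verts A) = card (verts X) * card (verts Y)"
    "\<And>M. card (periodic_points M A) = card (periodic_points M X) * card (periodic_points M Y)"
    "\<And>j. card (near_fixed j A) = card (near_fixed j X) * card (near_fixed j Y)"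
proof -
  obtain Y :: "nat fdigraph" where Y: "functional_digraph Y" "fd_iso (fd_prod X Y) A"
    using assms(2) by (auto simp: fd_dvd_def)
  have XY: "functional_digraph (fd_prod X Y)"
    using assms(1) Y(1) by (rule functional_digraph_prod)
  show ?thesis
  proof (rule that[OF Y(1)])
    show "card (verts A) = card (verts X) * card (verts Y)"
      using card_iso(1)[OF XY Y(2)] by (simp add: fd_prod_def card_cartesian_product)
    show "card (periodic_points M A) = card (periodic_points M X) * card (periodic_points M Y)" for M
      using card_iso(2)[OF XY Y(2)] by (simp add: periodic_points_prod card_cartesian_product)
    show "card (near_fixed j A) = card (near_fixed j X) * card (near_fixed j Y)" for j
      using card_iso(3)[OF XY Y(2)] by (simp add: near_fixed_prod card_cartesian_product)
  qed
qed

lemma orbit_repeats: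
  assumes X: "functional_digraph X" and v: "v \<in> verts X"
  obtains i j where "i < j" "j \<le> card (verts X)" "(out_nbr X ^^ i) v = (out_nbr X ^^ j) v"
proof -
  have "\<not> inj_on (\<lambda>i. (out_nbr X ^^ i) v) {..card (verts X)}"
  proof
    assume "inj_on (\<lambda>i. (out_nbr X ^^ i) v) {..card (verts X)}"
    then have "card {..card (verts X)} \<le> card (verts X)"
      using X iterate_in_verts[OF X v]
      by (intro card_inj_on_le) (auto simp: functional_digraph_def)
    then show False by simp
  qed
  then show ?thesis
    using that unfolding inj_on_def by (metis atMost_iff nat_neq_iff)
qed

text \<open>Within \<open>card (verts X)\<close> steps every orbit is on its cycle, and all cycle lengths divide the
  factorial; so iterating a factorial number of times projects onto the cycles.\<close>

lemma iterate_fact_idempotent: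
  assumes X: "functional_digraph X" and v: "v \<in> verts X"
  shows "(out_nbr X ^^ fact (card (verts X))) ((out_nbr X ^^ fact (card (verts X))) v)
       = (out_nbr X ^^ fact (card (verts X))) v"
proof -
  define f where "f = out_nbr X"
  define n where "n = card (verts X)"
  obtain i j where "i < j" "j \<le> n" and eq: "(f ^^ i) v = (f ^^ j) v"
    using orbit_repeats[OF X v] by (metis f_def n_def)
  define d where "d = j - i"
  have d: "0 < d" "d \<le> n" and j: "j = d + i"
    using \<open>i < j\<close> \<open>j \<le> n\<close> by (auto simp: d_def)
  have step: "(f ^^ (d + k)) v = (f ^^ k) v" if "i \<le> k" for k
  proof -
    define s where "s = k - i"
    have k: "k = s + i" using that by (simp add: s_def)
    have "d + k = s + j" by (simp add: j k)
    then have "(f ^^ (d + k)) v = (f ^^ s) ((f ^^ j) v)"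
      by (simp only: funpow_add o_apply)
    also have "\<dots> = (f ^^ k) v"
      by (simp only: eq[symmetric] k funpow_add o_apply)
    finally show ?thesis .
  qed
  have steps: "(f ^^ (q * d + k)) v = (f ^^ k) v" if "i \<le> k" for q k
  proof (induction q)
    case (Suc q)
    have "(f ^^ (Suc q * d + k)) v = (f ^^ (d + (q * d + k))) v"
      by (simp add: add.assoc)
    also have "\<dots> = (f ^^ (q * d + k)) v"
      using that by (intro step) simp
    finally show ?case using Suc by simp
  qed simp
  have "d dvd fact n" using d by (intro dvd_fact) auto
  then obtain q where q: "fact n = q * d" by (metis dvd_def mult.commute)
  have "i \<le> n" using \<open>i < j\<close> \<open>j \<le> n\<close> by simp
  then have "i \<le> fact n" using fact_ge_self le_trans by blast
  then have "(f ^^ (fact n + fact n)) v = (f ^^ fact n) v"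
    using steps[of "fact n" q] q by simp
  then show ?thesis by (simp add: funpow_add f_def n_def)
qed

section \<open>Cycles\<close>

definition cycle_digraph :: "int \<Rightarrow> int fdigraph" where
  "cycle_digraph m = \<lparr>verts = {0..<m}, out_nbr = (\<lambda>i. (i + 1) mod m)\<rparr>"

lemma functional_cycle: "0 < m \<Longrightarrow> functional_digraph (cycle_digraph m)"
  by (auto simp: functional_digraph_def cycle_digraph_def)

lemma iterate_add_one_mod:
  fixes m :: int
  assumes "0 \<le> i" "i < m"
  shows "((\<lambda>i. (i + 1) mod m) ^^ k) i = (i + int k) mod m"
proof (induction k)
  case (Suc k)
  then show ?case by (simp add: mod_add_left_eq add.assoc add.commute[of 1])
qed (use assms in simp)

lemma shift_fixed_iff:
  fixes m :: int
  assumes "0 \<le> i" "i < m"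
  shows "(i + int k) mod m = i \<longleftrightarrow> m dvd int k"
proof -
  have "(i + int k) mod m = i \<longleftrightarrow> (i + int k) mod m = i mod m"
    using assms by simp
  also have "\<dots> \<longleftrightarrow> m dvd int k"
    by (simp add: mod_eq_dvd_iff)
  finally show ?thesis .
qed

section \<open>Disconnected digraphs\<close>

text \<open>The set \<open>S\<close> is a union of components.  The digraph \<open>B\<close> below is \<open>p S + C\<^sub>p T\<close> written
  on one vertex set: a counter modulo \<open>p\<close> that stands still over \<open>S\<close> and runs over the rest \<open>T\<close>.
  Next to a second running counter, only the difference of the two matters, and that stands
  still, whence \<open>C\<^sub>p B = X Y\<close>.\<close>

lemma disconnected_not_prime:
  assumes X: "functional_digraph X"
    and S: "S \<subseteq> verts X" "S \<noteq> {}" "S \<noteq> verts X"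
    and S_inv: "\<And>x. x \<in> verts X \<Longrightarrow> out_nbr X x \<in> S \<longleftrightarrow> x \<in> S"
  shows "\<not> fd_prime X"
proof -
  define f where "f = out_nbr X"
  define V where "V = verts X"
  have fin: "finite V" and fV: "\<And>x. x \<in> V \<Longrightarrow> f x \<in> V"
    using X by (auto simp: functional_digraph_def V_def f_def)
  have fS: "f x \<in> S \<longleftrightarrow> x \<in> S" if "x \<in> V" for x
    using S_inv that by (simp add: V_def f_def)
  obtain s t where s: "s \<in> S" "s \<in> V" and t: "t \<in> V" "t \<notin> S"
    using S by (auto simp: V_def)
  define n where "n = card V"
  have "card {s, t} \<le> n"
    unfolding n_def using fin s t by (intro card_mono) auto
  moreover have "s \<noteq> t" using s t by auto
  ultimately have n: "2 \<le> n" by simp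
  \<comment> \<open>Every number from 1 to \<open>n\<close> divides \<open>M\<close> and is therefore prime to \<open>p\<close>, which exceeds \<open>M\<close>.\<close>
  define M :: nat where "M = fact n"
  define p where "p = int M + 1"
  have M: "0 < M" and p: "1 < p" "int M < p" "0 < p" by (auto simp: M_def p_def)
  define A where "A = cycle_digraph p"
  define B where "B = \<lparr>verts = V \<times> {0..<p},
    out_nbr = (\<lambda>(x, i). (f x, if x \<in> S then i else (i + 1) mod p))\<rparr>"
  define Y where "Y = \<lparr>verts = {0..<p} \<times> {0..<p},
    out_nbr = (\<lambda>(c, j). ((c + 1) mod p, j))\<rparr>"
  have A: "functional_digraph A" using p by (simp add: A_def functional_cycle)
  have B: "functional_digraph B"
    using fin fV p by (auto simp: functional_digraph_def B_def)
  have Y: "functional_digraph Y"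
    using p by (auto simp: functional_digraph_def Y_def)
  have iso: "fd_iso (fd_prod X Y) (fd_prod A B)"
  proof -
    define \<phi> where "\<phi> = (\<lambda>(x, (c, j)). (c, (x, if x \<in> S then j else (c + j) mod p)))"
    define \<psi> where "\<psi> = (\<lambda>(c, (x, i)). (x, (c, if x \<in> S then i else (i - c) mod p)))"
    have "bij_betw \<phi> (verts (fd_prod X Y)) (verts (fd_prod A B))"
      by (rule bij_betw_byWitness[where f' = \<psi>])
        (auto simp: \<phi>_def \<psi>_def fd_prod_def A_def B_def Y_def cycle_digraph_def V_def
          mod_simps)
    moreover have "\<phi> (out_nbr (fd_prod X Y) v) = out_nbr (fd_prod A B) (\<phi> v)"
      if "v \<in> verts (fd_prod X Y)" for v
      using that fS
      by (auto simp: \<phi>_def fd_prod_def A_def B_def Y_def cycle_digraph_def V_def f_def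
          mod_simps algebra_simps)
    ultimately show ?thesis unfolding fd_iso_def by blast
  qed
  have "\<not> fd_dvd X A"
  proof
    assume "fd_dvd X A"
    then obtain Z :: "nat fdigraph" where "card (verts A) = n * card (verts Z)"
      using fd_dvd_factorisations[OF X] by (metis n_def V_def)
    then have "n dvd M + 1"
      by (simp add: A_def cycle_digraph_def p_def nat_add_distrib)
    moreover have "n dvd M" using n by (simp add: M_def dvd_fact)
    ultimately have "n dvd 1" by (metis dvd_add_right_iff)
    then show False using n by simp
  qed
  moreover have "\<not> fd_dvd X B"
  proof
    assume "fd_dvd X B"
    then obtain Z :: "nat fdigraph"
      where Z: "card (periodic_points M B) = card (periodic_points M X) * card (periodic_points M Z)"
      using fd_dvd_factorisations[OF X] by metis
    have itS: "(f ^^ k) x \<in> S \<longleftrightarrow> x \<in> S" if "x \<in> V" for k x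
      using that fS fV by (induction k arbitrary: x) (auto simp: funpow_swap1)
    have itV: "(f ^^ k) x \<in> V" if "x \<in> V" for k x
      using iterate_in_verts[OF X] that by (simp add: V_def f_def)
    define P where "P = periodic_points M X"
    have P: "P \<subseteq> V" by (auto simp: P_def periodic_points_def V_def)
    have idem: "(f ^^ M) x \<in> P" if "x \<in> V" for x
      using iterate_fact_idempotent[OF X] itV that
      by (auto simp: P_def periodic_points_def V_def f_def M_def n_def)
    have itB: "(out_nbr B ^^ k) (x, i) = ((f ^^ k) x, if x \<in> S then i else (i + int k) mod p)"
      if "x \<in> V" "0 \<le> i" "i < p" for k x i
    proof (induction k)
      case (Suc k)
      then show ?case
        using that itS[OF that(1), of k]
        by (auto simp: B_def mod_simps algebra_simps)
    qed (use that in auto)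
    \<comment> \<open>The running counters do not return after \<open>M\<close> steps, so only vertices over \<open>S\<close> are counted.\<close>
    have notdvd: "\<not> p dvd int M"
      using p M by (auto dest: zdvd_imp_le)
    have "periodic_points M B = (P \<inter> S) \<times> {0..<p}"
    proof (intro set_eqI, clarify)
      fix x i
      show "(x, i) \<in> periodic_points M B \<longleftrightarrow> (x, i) \<in> (P \<inter> S) \<times> {0..<p}"
      proof (cases "x \<in> V \<and> 0 \<le> i \<and> i < p")
        case True
        then show ?thesis
          using itB[of x i M] shift_fixed_iff[of i p M] notdvd
          by (auto simp: periodic_points_def P_def V_def f_def B_def)
      next
        case False
        then show ?thesis using P by (auto simp: periodic_points_def B_def)
      qed
    qed
    then have "card (P \<inter> S) * (M + 1) = card P * card (periodic_points M Z)"
      using Z p by (simp add: card_cartesian_product P_def p_def nat_add_distrib)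
    then have dvd: "card P dvd card (P \<inter> S) * (M + 1)" by simp
    have finP: "finite P" using P fin by (rule finite_subset)
    have sP: "(f ^^ M) s \<in> P \<inter> S" using idem s itS by auto
    have tP: "(f ^^ M) t \<in> P - S" using idem t itS by auto
    have pos: "0 < card (P \<inter> S)" using sP finP by (auto simp: card_gt_0_iff)
    have lt: "card (P \<inter> S) < card P" using tP finP by (intro psubset_card_mono) auto
    have "card P \<le> n" unfolding n_def using fin P by (rule card_mono)
    then have "card P dvd M" using pos lt by (simp add: M_def dvd_fact)
    then have "card P dvd card (P \<inter> S) * M" by simp
    then have "card P dvd card (P \<inter> S)"
      using dvd by (simp add: distrib_left dvd_add_left_iff)
    then show False using pos lt by (auto dest: dvd_imp_le)
  qed
  ultimately show ?thesis using not_fd_primeI[OF X A B Y iso] by blast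
qed

section \<open>Connected digraphs with a long cycle\<close>

lemma funpow_multiple_fixed:
  assumes "(f ^^ d) v = v" "d dvd k"
  shows "(f ^^ k) v = v"
proof -
  obtain q where "k = d * q" using assms(2) by (rule dvdE)
  moreover have "((f ^^ d) ^^ q) v = v" using assms(1) by (induction q) auto
  ultimately show ?thesis by (simp add: funpow_mult mult.commute)
qed

text \<open>A cofactor \<open>Z\<close> has at most \<open>n\<close> vertices, so it has a cycle of some length \<open>d \<le> n\<close>.  Together
  with a cycle of length dividing \<open>n\<close> it returns after \<open>lcm n d\<close> steps, which can be a multiple of
  \<open>n\<^sup>2\<close> neither for \<open>d < n\<close> nor for \<open>d = n\<close>.\<close>

lemma long_periods_not_dvd:
  assumes X: "functional_digraph X" and n: "2 \<le> n"
    and r: "r \<in> verts X" "(out_nbr X ^^ n) r = r"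
    and G: "\<And>k. \<not> n * n dvd k \<Longrightarrow> periodic_points k G = {}"
    and cG: "0 < card (verts G)" "card (verts G) \<le> card (verts X) * n"
  shows "\<not> fd_dvd X G"
proof
  assume "fd_dvd X G"
  then obtain Z :: "nat fdigraph" where Z: "functional_digraph Z"
    "card (verts G) = card (verts X) * card (verts Z)"
    "\<And>k. card (periodic_points k G) = card (periodic_points k X) * card (periodic_points k Z)"
    using fd_dvd_factorisations[OF X] by metis
  have finZ: "finite (verts Z)" using Z(1) by (simp add: functional_digraph_def)
  have Zn: "card (verts Z) \<le> n" "0 < card (verts Z)"
    using cG Z(2) by auto
  then obtain z0 where z0: "z0 \<in> verts Z" by (auto simp: card_gt_0_iff)
  obtain i j where "i < j" "j \<le> n" and eq: "(out_nbr Z ^^ i) z0 = (out_nbr Z ^^ j) z0"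
    using orbit_repeats[OF Z(1) z0] Zn(1) by (metis le_trans)
  define z where "z = (out_nbr Z ^^ i) z0"
  define d where "d = j - i"
  have d: "0 < d" "d \<le> n" using \<open>i < j\<close> \<open>j \<le> n\<close> by (auto simp: d_def)
  have zV: "z \<in> verts Z" using iterate_in_verts[OF Z(1) z0] by (simp add: z_def)
  have "j = d + i" using \<open>i < j\<close> by (simp add: d_def)
  then have zd: "(out_nbr Z ^^ d) z = z"
    using eq by (simp add: z_def funpow_add)
  have finX: "finite (periodic_points k X)" for k
    using X by (simp add: periodic_points_def functional_digraph_def)
  have finZk: "finite (periodic_points k Z)" for k
    using finZ by (simp add: periodic_points_def)
  have square_dvd: "n * n dvd k" if "n dvd k" "d dvd k" for k
  proof (rule ccontr)
    assume "\<not> n * n dvd k"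
    then have "card (periodic_points k X) * card (periodic_points k Z) = 0"
      using G Z(3) by (metis card.empty)
    moreover have "r \<in> periodic_points k X"
      using r funpow_multiple_fixed[OF r(2) that(1)] by (simp add: periodic_points_def)
    moreover have "z \<in> periodic_points k Z"
      using zV funpow_multiple_fixed[OF zd that(2)] by (simp add: periodic_points_def)
    ultimately show False using finX finZk by auto
  qed
  have "n * n dvd n * d" using square_dvd[of "n * d"] by auto
  then have "n dvd d" using n by auto
  then have "d = n" using d by (auto dest: dvd_imp_le)
  then have "n * n dvd n" using square_dvd[of n] by auto
  then show False using n by (auto dest: dvd_imp_le)
qed

text \<open>The phase \<open>ph\<close> is a homomorphism to the cycle of length \<open>n\<close>, and the cover \<open>B\<close> is the fibre
  product of \<open>X\<close> and the cycle of length \<open>N = n\<^sup>2\<close> over it.  In the product of that cycle with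
  \<open>B\<close>, the difference of the two counters modulo \<open>N\<close> is constant along the dynamics.  Modulo \<open>m = n\<close>
  it is determined by the phase, so the remaining information is a free number \<open>q < n\<close>: the
  product is \<open>X\<close> times the cycle times \<open>n\<close> loops.\<close>

lemma phased_not_prime:
  fixes X :: "'a fdigraph" and ph :: "'a \<Rightarrow> int"
  assumes X: "functional_digraph X" and n: "2 \<le> n"
    and r: "r \<in> verts X" "(out_nbr X ^^ n) r = r"
    and ph_range: "\<And>x. x \<in> verts X \<Longrightarrow> 0 \<le> ph x \<and> ph x < int n"
    and ph_step: "\<And>x. x \<in> verts X \<Longrightarrow> ph (out_nbr X x) = (ph x + 1) mod int n"
  shows "\<not> fd_prime X"
proof -
  define f where "f = out_nbr X"
  define V where "V = verts X"
  have fin: "finite V" and fV: "\<And>x. x \<in> V \<Longrightarrow> f x \<in> V"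
    using X by (auto simp: functional_digraph_def V_def f_def)
  define m where "m = int n"
  define N where "N = m * m"
  have m: "2 \<le> m" and N: "0 < N" and mN: "m dvd N"
    using n by (auto simp: m_def N_def)
  have ph: "0 \<le> ph x" "ph x < m" "ph (f x) = (ph x + 1) mod m" if "x \<in> V" for x
    using ph_range ph_step that by (auto simp: V_def f_def m_def)
  have modmod: "i mod N mod m = i mod m" for i
    using mN by (rule mod_mod_cancel)
  have n_le: "n \<le> card V"
  proof -
    have it: "(f ^^ k) r \<in> V" for k
      using iterate_in_verts[OF X r(1)] by (simp add: V_def f_def)
    have ph_it: "ph ((f ^^ k) r) = (ph r + int k) mod m" for k
    proof (induction k)
      case 0
      then show ?case using ph[OF it[of 0]] by simp
    next
      case (Suc k)
      then show ?case using ph(3)[OF it[of k]] by (simp add: mod_simps algebra_simps)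
    qed
    have "j \<in> ph ` V" if "0 \<le> j" "j < m" for j
    proof -
      have "ph ((f ^^ nat ((j - ph r) mod m)) r) = j"
        using that m by (simp add: ph_it mod_simps)
      then show ?thesis using it by (metis imageI)
    qed
    then have "{0..<m} \<subseteq> ph ` V" by auto
    then have "card {0..<m} \<le> card (ph ` V)" using fin by (intro card_mono) auto
    also have "\<dots> \<le> card V" using fin by (rule card_image_le)
    finally show ?thesis by (simp add: m_def)
  qed
  define A where "A = cycle_digraph N"
  define B where "B = \<lparr>verts = {(x, i). x \<in> V \<and> 0 \<le> i \<and> i < N \<and> i mod m = ph x},
    out_nbr = (\<lambda>(x, i). (f x, (i + 1) mod N))\<rparr>"
  define Y where "Y = \<lparr>verts = {0..<N} \<times> {0..<m}, out_nbr = (\<lambda>(c, q). ((c + 1) mod N, q))\<rparr>"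
  have A: "functional_digraph A" using N by (simp add: A_def functional_cycle)
  have "verts B \<subseteq> V \<times> {0..<N}" by (auto simp: B_def)
  then have "finite (verts B)" by (rule finite_subset) (use fin in auto)
  moreover have "out_nbr B ` verts B \<subseteq> verts B"
  proof -
    have "(i + 1) mod N mod m = ph (f x)" if "x \<in> V" "i mod m = ph x" for x i
      using that ph(3)[of x] modmod[of "i + 1"] by (metis mod_add_left_eq)
    then show ?thesis using fV N by (auto simp: B_def)
  qed
  ultimately have B: "functional_digraph B" by (simp add: functional_digraph_def)
  have Y: "functional_digraph Y" using N by (auto simp: functional_digraph_def Y_def)
  have iso: "fd_iso (fd_prod A B) (fd_prod X Y)"
  proof -
    define \<phi> where "\<phi> = (\<lambda>(c, (x :: 'a, i)). (x, (c, (i - c) mod N div m)))"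
    define \<psi> where "\<psi> = (\<lambda>(x, (c, q)). (c, (x, (c + (q * m + (ph x - c) mod m)) mod N)))"
    have range: "0 \<le> q * m + d \<and> q * m + d < N"
      if "0 \<le> q" "q < m" "0 \<le> d" "d < m" for q d :: int
    proof -
      have "q * m \<le> (m - 1) * m" using that by (intro mult_right_mono) auto
      then show ?thesis using that by (auto simp: N_def algebra_simps)
    qed
    have "bij_betw \<phi> (verts (fd_prod A B)) (verts (fd_prod X Y))"
    proof (rule bij_betw_byWitness[where f' = \<psi>])
      show "\<forall>v\<in>verts (fd_prod A B). \<psi> (\<phi> v) = v"
      proof (clarsimp simp: fd_prod_def A_def B_def cycle_digraph_def \<phi>_def \<psi>_def)
        fix c x i assume h: "0 \<le> c" "c < N" "x \<in> V" "0 \<le> i" "i < N" "i mod m = ph x"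
        have "(ph x - c) mod m = (i - c) mod N mod m"
          unfolding modmod h(6)[symmetric] by (simp add: mod_simps)
        then have "(i - c) mod N div m * m + (ph x - c) mod m = (i - c) mod N"
          by simp
        then show "(c + ((i - c) mod N div m * m + (ph x - c) mod m)) mod N = i"
          using h by (simp add: mod_simps)
      qed
      show "\<forall>v\<in>verts (fd_prod X Y). \<phi> (\<psi> v) = v"
      proof (clarsimp simp: fd_prod_def Y_def \<phi>_def \<psi>_def)
        fix x c q assume h: "0 \<le> c" "c < N" "0 \<le> q" "q < m"
        define e where "e = q * m + (ph x - c) mod m"
        have "((c + e) mod N - c) mod N = e mod N" by (simp add: mod_simps)
        also have "\<dots> = e" using range[OF h(3,4), of "(ph x - c) mod m"] m by (simp add: e_def)
        finally show "((c + (q * m + (ph x - c) mod m)) mod N - c) mod N div m = q"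
          using m by (simp add: e_def)
      qed
      show "\<phi> ` verts (fd_prod A B) \<subseteq> verts (fd_prod X Y)"
      proof -
        have "0 \<le> d mod N div m \<and> d mod N div m < m" for d
        proof -
          have "d mod N < m * m" using N by (simp add: N_def)
          moreover have "0 \<le> d mod N" using N by simp
          moreover have "m * (d mod N div m) \<le> d mod N"
            using mult_div_mod_eq[of m "d mod N"] pos_mod_sign[of m "d mod N"] m by linarith
          ultimately have "m * (d mod N div m) < m * m" by linarith
          then show ?thesis
            using m \<open>0 \<le> d mod N\<close> by (simp add: pos_imp_zdiv_nonneg_iff)
        qed
        then show ?thesis
          by (auto simp: fd_prod_def A_def B_def Y_def cycle_digraph_def \<phi>_def V_def)
      qed
      show "\<psi> ` verts (fd_prod X Y) \<subseteq> verts (fd_prod A B)"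
      proof (clarsimp simp: fd_prod_def A_def B_def Y_def cycle_digraph_def \<psi>_def N V_def[symmetric])
        fix x c q assume "x \<in> V"
        have "(c + (q * m + (ph x - c) mod m)) mod m = (c + (q * m + (ph x - c))) mod m"
          by (metis mod_add_right_eq)
        also have "\<dots> = ph x mod m" by (simp add: algebra_simps)
        finally show "(c + (q * m + (ph x - c) mod m)) mod N mod m = ph x"
          using ph[OF \<open>x \<in> V\<close>] by (simp add: modmod)
      qed
    qed
    moreover have "\<phi> (out_nbr (fd_prod A B) v) = out_nbr (fd_prod X Y) (\<phi> v)" for v
      by (cases v) (simp add: \<phi>_def fd_prod_def A_def B_def Y_def cycle_digraph_def f_def
          mod_simps split: prod.splits)
    ultimately show ?thesis unfolding fd_iso_def by blast
  qed
  have cardAB: "card (verts A) = n * n" "card (verts B) = card V * n"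
  proof -
    show A': "card (verts A) = n * n"
      by (simp add: A_def cycle_digraph_def N_def m_def nat_mult_distrib)
    have "card (verts A) * card (verts B) = card (verts X) * card (verts Y)"
      using card_iso(1)[OF functional_digraph_prod[OF A B] iso]
      by (simp add: fd_prod_def card_cartesian_product)
    also have "card (verts Y) = n * n * n"
      by (simp add: Y_def card_cartesian_product N_def m_def nat_mult_distrib)
    finally show "card (verts B) = card V * n"
      using A' n by (simp add: V_def)
  qed
  have itA: "(out_nbr A ^^ k) c = (c + int k) mod N" if "c \<in> verts A" for k c
    using that iterate_add_one_mod[of c N k] by (simp add: A_def cycle_digraph_def)
  have itB: "snd ((out_nbr B ^^ k) v) = (snd v + int k) mod N" if "v \<in> verts B" for k v
  proof -
    have "snd ((out_nbr B ^^ k) v) = ((\<lambda>i. (i + 1) mod N) ^^ k) (snd v)"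
      by (induction k) (auto simp: B_def split: prod.splits)
    then show ?thesis using that iterate_add_one_mod[of "snd v" N k] by (auto simp: B_def)
  qed
  have Ndvd: "N dvd int k \<longleftrightarrow> n * n dvd k" for k
    by (metis N_def m_def of_nat_dvd_iff of_nat_mult)
  have "periodic_points k A = {}" "periodic_points k B = {}" if "\<not> n * n dvd k" for k
    using that Ndvd[of k] itA[of _ k] itB[of _ k] shift_fixed_iff[of _ N k]
    by (fastforce simp: periodic_points_def A_def cycle_digraph_def,
        fastforce simp: periodic_points_def B_def)
  note no_per = this
  have "\<not> fd_dvd X A"
    using no_per(1) cardAB n n_le by (intro long_periods_not_dvd[OF X n r]) (auto simp: V_def)
  moreover have "\<not> fd_dvd X B"
    using no_per(2) cardAB n n_le by (intro long_periods_not_dvd[OF X n r]) (auto simp: V_def)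
  ultimately show ?thesis
    using not_fd_primeI[OF X A B Y fd_iso_sym[OF functional_digraph_prod[OF A B] iso]] by blast
qed

section \<open>Trees with a loop at the root\<close>

text \<open>The number \<open>w\<close> stands for a word of base-\<open>b\<close> digits, and division by \<open>b\<close> drops the last one; this
  is the \<open>b\<close>-ary tree with root 0, in which \<open>w\<close> has height \<open>k\<close> iff its leading digit is the
  \<open>k\<close>-th from the right.  Let \<open>x\<close> be of height \<open>k\<close> and \<open>y\<close> be lower.  If \<open>w\<close> is
  lower as well, then \<open>(x, y, w)\<close> is swapped with \<open>(y, x, w')\<close>, where \<open>w'\<close> has an additional
  leading digit 1 in position \<open>k\<close>.  Both triples reach the root for the first time after \<open>k\<close>
  steps, and until then \<open>w\<close> and \<open>w'\<close> differ in the leading digit only.\<close>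

definition exchange :: "nat \<Rightarrow> ('a \<Rightarrow> nat) \<Rightarrow> 'a \<times> ('a \<times> nat) \<Rightarrow> 'a \<times> ('a \<times> nat)" where
  "exchange b ht = (\<lambda>(x, (y, w)).
     if ht y < ht x \<and> w < b ^ (ht x - 1) then (y, (x, w + b ^ (ht x - 1)))
     else if ht x < ht y \<and> b ^ (ht y - 1) \<le> w \<and> w < 2 * b ^ (ht y - 1)
       then (y, (x, w - b ^ (ht y - 1)))
     else (x, (y, w)))"

lemma exchange_exchange: "exchange b ht (exchange b ht v) = v"
  by (cases v) (auto simp: exchange_def)

text \<open>The condition for swapping looks only at heights relative to each other, and all heights drop by
  one in each step.  When the higher coordinate has height 1, both tree coordinates arrive
  at the root together and the extra digit disappears, so swapped and unswapped triples meet.\<close>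

lemma exchange_step:
  assumes b: "2 \<le> b"
    and htx: "ht (f x) = ht x - 1" and hty: "ht (f y) = ht y - 1"
    and low: "ht x \<le> 1 \<Longrightarrow> f x = r" "ht y \<le> 1 \<Longrightarrow> f y = r"
  shows "exchange b ht (f x, (f y, w div b)) =
    (case exchange b ht (x, (y, w)) of (x', (y', w')) \<Rightarrow> (f x', (f y', w' div b)))"
proof -
  have lt: "w div b < b ^ k \<longleftrightarrow> w < b ^ Suc k" for k
    using b by (simp add: div_less_iff_less_mult mult.commute)
  have lt2: "w div b < 2 * b ^ k \<longleftrightarrow> w < 2 * b ^ Suc k" for k
    using b by (simp add: div_less_iff_less_mult mult_ac)
  have ge: "b ^ k \<le> w div b \<longleftrightarrow> b ^ Suc k \<le> w" for k
    using lt[of k] by (meson not_less)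
  have add: "(u + b ^ Suc k) div b = u div b + b ^ k" for u k
    using b div_mult_self2[of b u "b ^ k"] by simp
  have sub: "(w - b ^ Suc k) div b = w div b - b ^ k" if "b ^ Suc k \<le> w" for k
  proof -
    define u where "u = w - b ^ Suc k"
    have "w = u + b ^ Suc k" using that by (simp add: u_def)
    then show ?thesis using add[of u k] by simp
  qed
  consider (down) "ht y < ht x" | (up) "ht x < ht y" | (level) "ht x = ht y" by linarith
  then show ?thesis
  proof cases
    case level
    then show ?thesis by (simp add: exchange_def htx hty)
  next
    case down
    show ?thesis
    proof (cases "ht x - 1")
      case 0
      then have "f x = r" "f y = r" using low down by auto
      then show ?thesis using down 0 b by (auto simp: exchange_def)
    next
      case (Suc k)
      then have "ht y - 1 < ht x - 1" using down by linarith
      then show ?thesis using down Suc by (simp add: exchange_def htx hty lt add del: power_Suc)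
    qed
  next
    case up
    show ?thesis
    proof (cases "ht y - 1")
      case 0
      then have "f x = r" "f y = r" using low up by auto
      then show ?thesis using up 0 b by (auto simp: exchange_def)
    next
      case (Suc k)
      then have "ht x - 1 < ht y - 1" using up by linarith
      then show ?thesis using up Suc by (simp add: exchange_def htx hty lt2 ge sub del: power_Suc)
    qed
  qed
qed

text \<open>Here \<open>V\<close> is the vertex set of \<open>E\<close>, a tree in which every vertex of height \<open>h\<close> has a child, and \<open>X\<close>
  is \<open>E\<close> cut off at height \<open>h\<close>.  For a new leaf \<open>l\<close>, of height \<open>h + 1\<close>, a vertex \<open>y\<close> of \<open>X\<close> and
  \<open>w < b\<^sup>h\<close>, the exchange always turns \<open>(l, y, w)\<close> into \<open>(y, l, w + b\<^sup>h)\<close>.  This is why \<open>Y\<close> combines new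
  leaves with numbers below \<open>2 b\<^sup>h\<close>.\<close>

lemma truncated_tree_not_prime:
  fixes V :: "'a set" and f :: "'a \<Rightarrow> 'a" and ht :: "'a \<Rightarrow> nat"
  assumes fin: "finite V" and fV: "\<And>v. v \<in> V \<Longrightarrow> f v \<in> V"
    and ht_step: "\<And>v. v \<in> V \<Longrightarrow> ht (f v) = ht v - 1"
    and root: "r \<in> V" and ht_0: "\<And>v. v \<in> V \<Longrightarrow> ht v = 0 \<longleftrightarrow> v = r"
    and ht_le: "\<And>v. v \<in> V \<Longrightarrow> ht v \<le> Suc h" and h: "1 \<le> h"
    and top: "\<exists>z\<in>V. ht z = h"
    and sprout: "\<And>z. z \<in> V \<Longrightarrow> ht z = h \<Longrightarrow> \<exists>l\<in>V. f l = z"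
  shows "\<not> fd_prime \<lparr>verts = {v \<in> V. ht v \<le> h}, out_nbr = f\<rparr>"
proof -
  define U where "U = {v \<in> V. ht v \<le> h}"
  define X where "X = \<lparr>verts = U, out_nbr = f\<rparr>"
  have UV: "U \<subseteq> V" and finU: "finite U" using fin by (auto simp: U_def)
  have fU: "f v \<in> U" if "v \<in> V" for v
    using that fV ht_step[OF that] ht_le[OF that] by (auto simp: U_def)
  have fr: "f r = r"
    using ht_0[OF fV[OF root]] ht_step[OF root] ht_0[OF root] by simp
  have rU: "r \<in> U" using root ht_0[OF root] by (simp add: U_def)
  have to_root: "f v = r \<longleftrightarrow> ht v \<le> 1" if "v \<in> V" for v
    using ht_0[OF fV[OF that]] ht_step[OF that] by auto
  have low: "f v = r" if "v \<in> V" "ht v \<le> 1" for v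
    using that to_root by blast
  have it: "(f ^^ k) v \<in> V" "ht ((f ^^ k) v) = ht v - k" if "v \<in> V" for k v
    using that by (induction k) (auto simp: fV ht_step)
  obtain z where z: "z \<in> U" "ht z = h" using top by (auto simp: U_def)
  \<comment> \<open>With this base the size \<open>b\<^sup>h\<close> of \<open>B\<close> is prime to the size of \<open>X\<close>.\<close>
  define b where "b = card U + 1"
  have "card {r, z} \<le> card U" using rU z finU by (intro card_mono) auto
  moreover have "r \<noteq> z" using z h ht_0[OF root] by auto
  ultimately have cU: "2 \<le> card U" by simp
  then have b: "2 \<le> b" by (simp add: b_def)
  define A where "A = \<lparr>verts = {(x, y). x \<in> V \<and> y \<in> V \<and> (ht x \<le> h \<or> ht y \<le> h)},
    out_nbr = (\<lambda>(x, y). (f x, f y))\<rparr>"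
  define B where "B = \<lparr>verts = {..<b ^ h}, out_nbr = (\<lambda>w. w div b)\<rparr>"
  define Y where "Y = \<lparr>verts = {(v, w). v \<in> V \<and> w < (if ht v \<le> h then b ^ h else 2 * b ^ h)},
    out_nbr = (\<lambda>(v, w). (f v, w div b))\<rparr>"
  have X: "functional_digraph X"
    using finU fU UV by (auto simp: functional_digraph_def X_def)
  have "verts A \<subseteq> V \<times> V" by (auto simp: A_def)
  then have finA: "finite (verts A)" by (rule finite_subset) (use fin in auto)
  then have A: "functional_digraph A"
    using fU fV by (auto simp: functional_digraph_def A_def U_def)
  have B: "functional_digraph B"
    using b by (auto simp: functional_digraph_def B_def intro: le_less_trans[OF div_le_dividend])
  have "verts Y \<subseteq> V \<times> {..<2 * b ^ h}" by (auto simp: Y_def split: if_splits)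
  then have "finite (verts Y)" by (rule finite_subset) (use fin in auto)
  moreover have "w div b < b ^ h" if "w < 2 * b ^ h" for w
  proof -
    have "2 * b ^ h \<le> b * b ^ h" using b by (rule mult_right_mono) simp
    then have "w < b * b ^ h" using that by linarith
    then show ?thesis using b by (simp add: div_less_iff_less_mult mult.commute)
  qed
  moreover have "b ^ h \<le> 2 * b ^ h" by simp
  ultimately have Y: "functional_digraph Y"
    using fU by (fastforce simp: functional_digraph_def Y_def U_def split: if_splits)
  have iso: "fd_iso (fd_prod X Y) (fd_prod A B)"
  proof -
    define \<alpha> where "\<alpha> = (\<lambda>(x, (y, w)). ((x, y), w :: nat) :: ('a \<times> 'a) \<times> nat)"
    define \<beta> where "\<beta> = (\<lambda>((x, y), w :: nat). (x, (y, w)) :: 'a \<times> ('a \<times> nat))"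
    have pow_le: "2 * b ^ (k - 1) \<le> b ^ h" if "1 \<le> k" "k \<le> h" for k
    proof -
      have "2 * b ^ (k - 1) \<le> b * b ^ (k - 1)" using b by (rule mult_right_mono) simp
      also have "\<dots> = b ^ k" using that by (cases k) auto
      also have "\<dots> \<le> b ^ h" using that b by (intro power_increasing) auto
      finally show ?thesis .
    qed
    have "bij_betw (\<alpha> \<circ> exchange b ht) (verts (fd_prod X Y)) (verts (fd_prod A B))"
    proof (rule bij_betw_byWitness[where f' = "exchange b ht \<circ> \<beta>"])
      have "\<beta> (\<alpha> v) = v" "\<alpha> (\<beta> u) = u" for u v by (auto simp: \<alpha>_def \<beta>_def split: prod.splits)
      then show "\<forall>v\<in>verts (fd_prod X Y). (exchange b ht \<circ> \<beta>) ((\<alpha> \<circ> exchange b ht) v) = v"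
        "\<forall>u\<in>verts (fd_prod A B). (\<alpha> \<circ> exchange b ht) ((exchange b ht \<circ> \<beta>) u) = u"
        by (auto simp: exchange_exchange)
      show "(\<alpha> \<circ> exchange b ht) ` verts (fd_prod X Y) \<subseteq> verts (fd_prod A B)"
      proof (rule image_subsetI)
        fix v assume v_in: "v \<in> verts (fd_prod X Y)"
        obtain x y w where v: "v = (x, (y, w))" by (cases v) auto
        with v_in have hyp: "x \<in> V" "ht x \<le> h" "y \<in> V" "w < (if ht y \<le> h then b ^ h else 2 * b ^ h)"
          by (auto simp: fd_prod_def X_def Y_def U_def)
        have y: "ht y \<le> h \<or> ht y = Suc h" using ht_le[OF hyp(3)] by linarith
        consider (down) "ht y < ht x" "w < b ^ (ht x - 1)"
          | (up) "ht x < ht y" "b ^ (ht y - 1) \<le> w" "w < 2 * b ^ (ht y - 1)"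
          | (id) "\<not> (ht y < ht x \<and> w < b ^ (ht x - 1))"
              "\<not> (ht x < ht y \<and> b ^ (ht y - 1) \<le> w \<and> w < 2 * b ^ (ht y - 1))"
          by blast
        then show "(\<alpha> \<circ> exchange b ht) v \<in> verts (fd_prod A B)"
        proof cases
          case down
          then show ?thesis using hyp pow_le[of "ht x"]
            by (auto simp: v exchange_def \<alpha>_def fd_prod_def A_def B_def)
        next
          case up
          have "w - b ^ (ht y - 1) < b ^ h"
            using y up pow_le[of "ht y"] by auto
          then show ?thesis using hyp up
            by (auto simp: v exchange_def \<alpha>_def fd_prod_def A_def B_def)
        next
          case id
          have "w < b ^ h"
            using y id(2) hyp by (auto split: if_splits)
          moreover have "exchange b ht (x, (y, w)) = (x, (y, w))"
            unfolding exchange_def prod.case using id by (simp only: if_False)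
          ultimately show ?thesis using hyp
            by (auto simp: v \<alpha>_def fd_prod_def A_def B_def)
        qed
      qed
      show "(exchange b ht \<circ> \<beta>) ` verts (fd_prod A B) \<subseteq> verts (fd_prod X Y)"
      proof (rule image_subsetI)
        fix v assume v_in: "v \<in> verts (fd_prod A B)"
        obtain x y w where v: "v = ((x, y), w)" by (cases v) auto
        with v_in have hyp: "x \<in> V" "y \<in> V" "ht x \<le> h \<or> ht y \<le> h" "w < b ^ h"
          by (auto simp: fd_prod_def A_def B_def)
        have x: "ht x \<le> h \<or> ht x = Suc h" using ht_le[OF hyp(1)] by linarith
        consider (down) "ht y < ht x" "w < b ^ (ht x - 1)"
          | (up) "ht x < ht y" "b ^ (ht y - 1) \<le> w" "w < 2 * b ^ (ht y - 1)"
          | (id) "\<not> (ht y < ht x \<and> w < b ^ (ht x - 1))"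
              "\<not> (ht x < ht y \<and> b ^ (ht y - 1) \<le> w \<and> w < 2 * b ^ (ht y - 1))"
          by blast
        then show "(exchange b ht \<circ> \<beta>) v \<in> verts (fd_prod X Y)"
        proof cases
          case down
          then show ?thesis using hyp x pow_le[of "ht x"]
            by (auto simp: v exchange_def \<beta>_def fd_prod_def X_def Y_def U_def)
        next
          case up
          then have "ht y \<noteq> Suc h" using hyp by auto
          then have "ht y \<le> h" using ht_le[OF hyp(2)] by linarith
          then show ?thesis using hyp up
            by (auto simp: v exchange_def \<beta>_def fd_prod_def X_def Y_def U_def)
        next
          case id
          have "ht x \<le> h" using x id(1) hyp by auto
          moreover have "exchange b ht (x, (y, w)) = (x, (y, w))"
            unfolding exchange_def prod.case using id by (simp only: if_False)
          ultimately show ?thesis using hyp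
            by (auto simp: v \<beta>_def fd_prod_def X_def Y_def U_def)
        qed
      qed
    qed
    moreover have "(\<alpha> \<circ> exchange b ht) (out_nbr (fd_prod X Y) v)
        = out_nbr (fd_prod A B) ((\<alpha> \<circ> exchange b ht) v)"
      if "v \<in> verts (fd_prod X Y)" for v
    proof -
      obtain x y w where v: "v = (x, (y, w))" by (cases v) auto
      have xy: "x \<in> V" "y \<in> V" using that by (auto simp: v fd_prod_def X_def Y_def U_def)
      have "exchange b ht (f x, (f y, w div b)) =
          (case exchange b ht v of (x', (y', w')) \<Rightarrow> (f x', (f y', w' div b)))"
        unfolding v using b ht_step[OF xy(1)] ht_step[OF xy(2)] low xy
        by (intro exchange_step) auto
      then show ?thesis
        by (auto simp: v \<alpha>_def fd_prod_def X_def Y_def A_def B_def split: prod.splits)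
    qed
    ultimately show ?thesis unfolding fd_iso_def by blast
  qed
  have "\<not> fd_dvd X B"
  proof
    assume "fd_dvd X B"
    then obtain Z :: "nat fdigraph" where "card (verts B) = card (verts X) * card (verts Z)"
      using fd_dvd_factorisations[OF X] by metis
    then have "card U dvd b ^ h" by (simp add: B_def X_def)
    moreover have "coprime (card U) b" by (simp add: b_def)
    ultimately have "is_unit (card U)"
      by (meson coprime_power_right_iff coprime_common_divisor dvd_refl)
    then show False using cU by simp
  qed
  moreover have "\<not> fd_dvd X A"
  proof
    assume "fd_dvd X A"
    then obtain Z :: "nat fdigraph" where Z: "functional_digraph Z"
      "\<And>j. card (near_fixed j A) = card (near_fixed j X) * card (near_fixed j Z)"
      using fd_dvd_factorisations[OF X] by metis
    \<comment> \<open>Let \<open>K\<close> be the roots of the branches of \<open>X\<close> that reach up \<open>g = h - 1\<close> levels, the loop included.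
      Only the loop reaches up \<open>h\<close> levels in \<open>X\<close>, but the new leaves give \<open>2 |K| - 1\<close> such
      branches in \<open>A\<close>, which has at most \<open>|K|\<^sup>2\<close> branches that reach up \<open>g\<close> levels.  A
      cofactor would have \<open>2 |K| - 1\<close> branches of the first kind and only \<open>|K|\<close> of the second,
      although the first kind is contained in the second.\<close>
    obtain g where g: "h = Suc g" using h by (cases h) auto
    define K where "K = (f ^^ g) ` U"
    have finK: "finite K" using finU by (simp add: K_def)
    have itr: "(f ^^ k) r = r" for k using fr by (induction k) auto
    have rK: "r \<in> K" unfolding K_def using rU itr by (metis imageI)
    have zK: "(f ^^ g) z \<in> K" "(f ^^ g) z \<noteq> r"
      using z it[of z g] ht_0[OF root] UV by (auto simp: K_def g)
    have "card {r, (f ^^ g) z} \<le> card K" using finK rK zK by (intro card_mono) auto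
    then have K2: "2 \<le> card K" using zK(2) by simp
    have itA: "(out_nbr A ^^ k) (x, y) = ((f ^^ k) x, (f ^^ k) y)" for k x y
      by (induction k) (auto simp: A_def)
    have fixed: "f v = r" if "v \<in> V" "f (f v) = f v" for v
    proof -
      have "ht (f v) - 1 = ht (f v)" using that fV ht_step by metis
      then show ?thesis using that to_root ht_step[of v] by simp
    qed
    have ht1: "ht v \<le> 1" if "v \<in> V" "f v = r" for v
      using that to_root by blast
    have Xg: "near_fixed g X = K"
    proof -
      have "f (f v) = f v" if "v \<in> K" for v
        using that it low UV fr by (auto simp: K_def U_def g)
      then show ?thesis by (auto simp: near_fixed_def X_def K_def)
    qed
    have "(f ^^ h) v = r" if "v \<in> U" for v
      using that it[of v h] ht_0 by (auto simp: U_def)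
    then have "near_fixed h X = {r}"
      using rU fr by (force simp: near_fixed_def X_def)
    then have Zh: "card (near_fixed h A) = card (near_fixed h Z)"
      using Z(2)[of h] by simp
    have "near_fixed g A \<subseteq> K \<times> K"
    proof clarify
      fix p q assume "(p, q) \<in> near_fixed g A"
      then obtain x y where xy: "x \<in> V" "y \<in> V" "p = (f ^^ g) x" "q = (f ^^ g) y"
        and stab: "f (f p) = f p" "f (f q) = f q"
        by (auto simp: near_fixed_def A_def itA[unfolded A_def, simplified])
      have "ht x - g \<le> 1" "ht y - g \<le> 1"
        using xy stab fixed ht1 it by metis+
      then have "x \<in> U" "y \<in> U" using xy by (auto simp: U_def g)
      then show "p \<in> K \<and> q \<in> K" using xy by (auto simp: K_def)
    qed
    then have "card (near_fixed g A) \<le> card K * card K"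
      using finK by (metis card_cartesian_product card_mono finite_cartesian_product)
    then have Zg: "card (near_fixed g Z) \<le> card K"
      using Z(2)[of g] K2 by (simp add: Xg)
    have past: "\<exists>l\<in>V. (f ^^ h) l = k" if "k \<in> K" for k
    proof -
      obtain x where x: "x \<in> U" "k = (f ^^ g) x" using \<open>k \<in> K\<close> by (auto simp: K_def)
      show ?thesis
      proof (cases "ht x = h")
        case True
        then obtain l where "l \<in> V" "f l = x" using sprout x UV by blast
        then show ?thesis using x by (auto simp: g funpow_swap1)
      next
        case False
        then have "ht x \<le> g" using x by (auto simp: U_def g)
        then have "k = r" using x it[of x g] UV ht_0 by auto
        then show ?thesis using root itr by blast
      qed
    qed
    have Kfix: "f k = r" if "k \<in> K" for k
      using that it low UV by (auto simp: K_def U_def g)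
    have sub: "{r} \<times> K \<union> K \<times> {r} \<subseteq> near_fixed h A"
    proof -
      have "(r, k) \<in> near_fixed h A \<and> (k, r) \<in> near_fixed h A" if k: "k \<in> K" for k
      proof -
        obtain l where l: "l \<in> V" "(f ^^ h) l = k" using past k by blast
        have "(r, l) \<in> verts A" "(l, r) \<in> verts A"
          using l rU root by (auto simp: A_def U_def)
        moreover have "(out_nbr A ^^ h) (r, l) = (r, k)" "(out_nbr A ^^ h) (l, r) = (k, r)"
          using l itr by (auto simp: itA)
        ultimately have "(r, k) \<in> (out_nbr A ^^ h) ` verts A" "(k, r) \<in> (out_nbr A ^^ h) ` verts A"
          by (metis imageI)+
        then show ?thesis using Kfix[OF k] fr by (auto simp: near_fixed_def A_def)
      qed
      then show ?thesis by auto
    qed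
    have "finite (near_fixed h A)"
      using finA by (simp add: near_fixed_def)
    then have "card ({r} \<times> K \<union> K \<times> {r}) \<le> card (near_fixed h A)"
      using sub by (rule card_mono)
    moreover have "card ({r} \<times> K \<union> K \<times> {r}) + 1 = 2 * card K"
    proof -
      have "({r} \<times> K) \<inter> (K \<times> {r}) = {(r, r)}" using rK by auto
      then show ?thesis
        using card_Un_Int[of "{r} \<times> K" "K \<times> {r}"] finK by (simp add: card_cartesian_product)
    qed
    moreover have "card (near_fixed h Z) \<le> card (near_fixed g Z)"
    proof (rule card_mono)
      show "finite (near_fixed g Z)"
        using Z(1) by (auto simp: near_fixed_def functional_digraph_def)
      show "near_fixed h Z \<subseteq> near_fixed g Z"
        using Z(1) by (auto simp: near_fixed_def functional_digraph_def g funpow_swap1)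
    qed
    ultimately show False using Zh Zg K2 by linarith
  qed
  ultimately have "\<not> fd_prime X" using not_fd_primeI[OF X A B Y iso] by blast
  then show ?thesis by (simp add: X_def U_def)
qed

lemma rooted_tree_not_prime:
  assumes X: "functional_digraph X"
    and root: "r \<in> verts X" "out_nbr X r = r"
    and reach: "\<And>x. x \<in> verts X \<Longrightarrow> \<exists>i. (out_nbr X ^^ i) x = r"
    and nontrivial: "verts X \<noteq> {r}"
  shows "\<not> fd_prime X"
proof -
  define f where "f = out_nbr X"
  define V where "V = verts X"
  have fin: "finite V" and fV: "\<And>x. x \<in> V \<Longrightarrow> f x \<in> V"
    using X by (auto simp: functional_digraph_def V_def f_def)
  have rV: "r \<in> V" and fr: "f r = r" using root by (auto simp: V_def f_def)
  define ht where "ht x = (LEAST i. (f ^^ i) x = r)" for x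
  have ht: "(f ^^ ht x) x = r" if "x \<in> V" for x
    unfolding ht_def by (rule LeastI_ex) (use reach that in \<open>simp add: V_def f_def\<close>)
  have ht_r: "ht r = 0" by (simp add: ht_def)
  have ht_0: "ht x = 0 \<longleftrightarrow> x = r" if "x \<in> V" for x
    using ht[OF that] ht_r by (metis funpow_0)
  have ht_step: "ht (f x) = ht x - 1" if "x \<in> V" for x
  proof (cases "x = r")
    case False
    have "ht x = Suc (LEAST i. (f ^^ Suc i) x = r)"
      unfolding ht_def using ht[OF that] False by (intro Least_Suc) auto
    then show ?thesis by (simp add: ht_def funpow_swap1)
  qed (simp add: fr ht_r)
  define h where "h = Max (ht ` V)"
  have ht_le: "ht x \<le> h" if "x \<in> V" for x
    using that fin by (simp add: h_def)
  have "h \<in> ht ` V" unfolding h_def using fin rV by (intro Max_in) auto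
  then obtain z where z: "z \<in> V" "ht z = h" by auto
  obtain x where "x \<in> V" "x \<noteq> r" using nontrivial rV by (auto simp: V_def)
  then have h: "1 \<le> h" using ht_0 ht_le by (metis One_nat_def Suc_leI le_zero_eq not_gr_zero)
  \<comment> \<open>The copy \<open>Inr z\<close> of a vertex \<open>z\<close> of maximal height is the new leaf on \<open>z\<close>.\<close>
  define W where "W = Inl ` V \<union> Inr ` {z \<in> V. ht z = h}"
  define g where "g = case_sum (\<lambda>x. Inl (f x) :: 'a + 'a) Inl"
  define hg where "hg = case_sum ht (\<lambda>_ :: 'a. Suc h)"
  define X' where "X' = \<lparr>verts = {v \<in> W. hg v \<le> h}, out_nbr = g\<rparr>"
  have trunc: "{v \<in> W. hg v \<le> h} = Inl ` V" using ht_le by (auto simp: W_def hg_def)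
  have "\<not> fd_prime X'"
    unfolding X'_def
  proof (rule truncated_tree_not_prime[where r = "Inl r"])
    show "finite W" using fin by (simp add: W_def)
    show "g v \<in> W" if "v \<in> W" for v using that fV by (auto simp: W_def g_def)
    show "hg (g v) = hg v - 1" if "v \<in> W" for v
      using that ht_step by (auto simp: W_def g_def hg_def)
    show "Inl r \<in> W" using rV by (simp add: W_def)
    show "hg v = 0 \<longleftrightarrow> v = Inl r" if "v \<in> W" for v
      using that ht_0 by (auto simp: W_def hg_def)
    show "hg v \<le> Suc h" if "v \<in> W" for v
      using that ht_le by (auto simp: W_def hg_def le_SucI)
    show "1 \<le> h" by fact
    show "\<exists>z\<in>W. hg z = h"
      using z by (intro bexI[of _ "Inl z"]) (auto simp: W_def hg_def)
    show "\<exists>l\<in>W. g l = v" if "v \<in> W" "hg v = h" for v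
      using that by (intro bexI[of _ "Inr (projl v)"]) (auto simp: W_def g_def hg_def)
  qed
  moreover have "fd_prime X'" if "fd_prime X"
  proof (rule fd_prime_iso[OF that])
    show "functional_digraph X'"
      using fin fV by (auto simp: functional_digraph_def X'_def trunc g_def)
    show "fd_iso X X'"
      unfolding fd_iso_def X'_def trunc
      by (intro exI[of _ Inl]) (auto simp: g_def bij_betw_def V_def f_def)
  qed
  ultimately show ?thesis by blast
qed

section \<open>The three cases cover all functional digraphs\<close>

text \<open>Take a vertex \<open>r\<close> on a cycle.  The vertices that eventually reach \<open>r\<close> form a component, so in a
  prime digraph they are all vertices.  The time needed to reach \<open>r\<close> is then the height if
  \<open>r\<close> carries a loop, and in general its negative modulo the length of the cycle is a
  phase.\<close>

theorem theorem1: "\<not> (\<exists>X :: 'a fdigraph. fd_prime X)"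
proof
  assume "\<exists>X :: 'a fdigraph. fd_prime X"
  then obtain X :: "'a fdigraph" where prime: "fd_prime X" ..
  then have X: "functional_digraph X" and "verts X \<noteq> {}" and not_C1: "\<not> fd_iso X C1"
    by (auto simp: fd_prime_def)
  then obtain x0 where x0: "x0 \<in> verts X" by auto
  define f where "f = out_nbr X"
  define V where "V = verts X"
  define M :: nat where "M = fact (card V)"
  define r where "r = (f ^^ M) x0"
  have rV: "r \<in> V" using iterate_in_verts[OF X x0] by (simp add: r_def f_def V_def)
  have rM: "(f ^^ M) r = r"
    using iterate_fact_idempotent[OF X x0] by (simp add: r_def f_def M_def V_def)
  have M: "0 < M" by (simp add: M_def)
  define S where "S = {x \<in> V. \<exists>i. (f ^^ i) x = r}"
  have S_inv: "f x \<in> S \<longleftrightarrow> x \<in> S" if x: "x \<in> V" for x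
  proof
    assume "f x \<in> S"
    then obtain i where "(f ^^ i) (f x) = r" by (auto simp: S_def)
    then have "(f ^^ Suc i) x = r" by (simp add: funpow_swap1)
    then show "x \<in> S" unfolding S_def using x by blast
  next
    assume "x \<in> S"
    then obtain i where "(f ^^ i) x = r" by (auto simp: S_def)
    then have "(f ^^ (M + i)) x = r" using rM by (simp add: funpow_add)
    moreover obtain j where "M + i = Suc j" using M by (cases "M + i") auto
    ultimately have "(f ^^ j) (f x) = r" by (simp add: funpow_swap1)
    moreover have "f x \<in> V" using X x by (auto simp: functional_digraph_def f_def V_def)
    ultimately show "f x \<in> S" unfolding S_def by blast
  qed
  have "r \<in> S" using rV unfolding S_def by (metis (mono_tags, lifting) funpow_0 mem_Collect_eq)
  then have "S = V"
    using disconnected_not_prime[OF X, of S] S_inv prime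
    by (auto simp: S_def V_def f_def)
  then have reach: "\<exists>i. (f ^^ i) x = r" if "x \<in> V" for x
    using that by (auto simp: S_def)
  define n where "n = (LEAST n. 0 < n \<and> (f ^^ n) r = r)"
  have "0 < n \<and> (f ^^ n) r = r"
    unfolding n_def by (rule LeastI[of _ M]) (use M rM in simp)
  then have n: "0 < n" "(f ^^ n) r = r" by auto
  have n_dvd: "n dvd k" if "(f ^^ k) r = r" for k
  proof -
    have "(f ^^ (k mod n)) r = r" using funpow_mod_eq[OF n(2)] that by metis
    moreover have "k mod n < n" using n by simp
    ultimately have "k mod n = 0" using not_less_Least n_def by blast
    then show ?thesis by auto
  qed
  show False
  proof (cases "n = 1")
    case True
    then have "f r = r" using n(2) by simp
    moreover have "V \<noteq> {r}"
    proof
      assume "V = {r}"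
      then have "fd_iso X C1"
        by (auto simp: fd_iso_def C1_def V_def bij_betw_def)
      with not_C1 show False by blast
    qed
    ultimately show False
      using rooted_tree_not_prime[OF X, of r] rV reach prime by (auto simp: V_def f_def)
  next
    case False
    then have n2: "2 \<le> n" using n by simp
    have sync_le: "int i mod int n = int j mod int n"
      if "(f ^^ i) x = r" "(f ^^ j) x = r" "i \<le> j" for i j x
    proof -
      have "(f ^^ (j - i + i)) x = r" using that by simp
      then have "(f ^^ (j - i)) r = r" using that(1) by (simp only: funpow_add o_apply)
      then have "int n dvd int (j - i)" using n_dvd by simp
      then show ?thesis
        using that(3) by (metis mod_eq_dvd_iff of_nat_diff)
    qed
    then have sync: "int i mod int n = int j mod int n"
      if "(f ^^ i) x = r" "(f ^^ j) x = r" for i j x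
      using that by (metis nat_le_linear)
    define s where "s x = (LEAST i. (f ^^ i) x = r)" for x
    have s: "(f ^^ s x) x = r" if "x \<in> V" for x
      unfolding s_def using reach[OF that] by (rule LeastI_ex)
    define ph where "ph x = (- int (s x)) mod int n" for x
    have "ph (f x) = (ph x + 1) mod int n" if x: "x \<in> V" for x
    proof -
      have "f x \<in> V" using X x by (auto simp: functional_digraph_def f_def V_def)
      then have "(f ^^ Suc (s (f x))) x = r" using s by (simp add: funpow_swap1)
      then have "int (s x) mod int n = (int (s (f x)) + 1) mod int n"
        using sync[OF s[OF x], of "Suc (s (f x))"] by (simp add: add.commute del: funpow.simps)
      then have "(1 - int (s x)) mod int n = (1 - (int (s (f x)) + 1)) mod int n"
        by (metis mod_diff_right_eq)
      then show ?thesis by (simp add: ph_def mod_simps)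
    qed
    moreover have "0 \<le> ph x \<and> ph x < int n" for x using n by (simp add: ph_def)
    ultimately show False
      using phased_not_prime[OF X n2, of r ph] rV n(2) prime by (auto simp: V_def f_def)
  qed
qed

end
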